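(* Let $\Pi=\mathbb{R}/\mathbb{Z}$ be the circle, let $a\in C^2(\Pi)$ with $a>0$, and let $c\in C^0(\Pi)$. For $\epsilon>0$ let $\lambda_\epsilon$ be the principal eigenvalue of the operator $L_\epsilon u=\epsilon\,a\,u''+c\,u$ on $\Pi$. Then $$\lim_{\epsilon\to0}\lambda_\epsilon=\max_{x\in\Pi}c(x).$$
   Context: The principal eigenvalue of $L_\epsilon$ is the eigenvalue with maximal real part (it is real, and admits a positive eigenfunction in $C^2(\Pi)$). *)

theory Defs
  imports "HOL-Analysis.Analysis" "HOL-Library.Periodic_Fun"
begin

text \<open>
  Functions on the circle \<open>\<real>/\<int>\<close> are represented by their lifts: 1-periodic
  functions on \<^typ>\<open>real\<close>.
\<close>

definition circle_C0 :: "(real \<Rightarrow> 'a::real_normed_vector) \<Rightarrow> bool" where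
  "circle_C0 f \<longleftrightarrow> periodic_fun_simple' f \<and> continuous_on UNIV f"

abbreviation vderiv :: "(real \<Rightarrow> 'a::real_normed_vector) \<Rightarrow> real \<Rightarrow> 'a" where
  "vderiv f \<equiv> (\<lambda>x. vector_derivative f (at x))"

definition circle_C2 :: "(real \<Rightarrow> 'a::real_normed_vector) \<Rightarrow> bool" where
  "circle_C2 f \<longleftrightarrow> periodic_fun_simple' f \<and>
     f C1_differentiable_on UNIV \<and> vderiv f C1_differentiable_on UNIV"

definition L_op :: "(real \<Rightarrow> real) \<Rightarrow> (real \<Rightarrow> real) \<Rightarrow> real \<Rightarrow> (real \<Rightarrow> complex) \<Rightarrow> real \<Rightarrow> complex" where
  "L_op a c \<epsilon> u x = (\<epsilon> * a x) *\<^sub>R vderiv (vderiv u) x + c x *\<^sub>R u x"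

text \<open>
  Eigenvalues are complex, with complex-valued classical eigenfunctions (for continuous
  coefficients with \<open>\<epsilon> a > 0\<close>, weak eigenfunctions are automatically \<open>C\<^sup>2\<close>).
\<close>

definition is_eigenvalue :: "(real \<Rightarrow> real) \<Rightarrow> (real \<Rightarrow> real) \<Rightarrow> real \<Rightarrow> complex \<Rightarrow> bool" where
  "is_eigenvalue a c \<epsilon> \<mu> \<longleftrightarrow>
     (\<exists>u. circle_C2 u \<and> (\<exists>x. u x \<noteq> 0) \<and> (\<forall>x. L_op a c \<epsilon> u x = \<mu> * u x))"

text \<open>
  That such an eigenvalue exists, is real and has a positive eigenfunction is not part of the
  definition.
\<close>

definition is_principal_eigenvalue :: "(real \<Rightarrow> real) \<Rightarrow> (real \<Rightarrow> real) \<Rightarrow> real \<Rightarrow> complex \<Rightarrow> bool" where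
  "is_principal_eigenvalue a c \<epsilon> \<mu> \<longleftrightarrow>
     is_eigenvalue a c \<epsilon> \<mu> \<and> (\<forall>\<nu>. is_eigenvalue a c \<epsilon> \<nu> \<longrightarrow> Re \<nu> \<le> Re \<mu>)"

end

theory Submission
  imports Defs "HOL-Complex_Analysis.Great_Picard"
begin

text \<open>
  For an eigenfunction \<open>u\<close> the derivative of the periodic function \<open>cnj u * u'\<close> has imaginary part
  \<open>Im \<mu> r |u|\<^sup>2\<close> and real part \<open>|u'|\<^sup>2 + (Re \<mu> - c) r |u|\<^sup>2\<close>, where \<open>r = 1 / (\<epsilon> a)\<close>. A monotone periodic
  function is constant, so every eigenvalue is real and at most \<open>max c\<close>.

  For the lower bound, consider the values \<open>l\<close> for which some positive periodic \<open>u\<close> satisfies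
  \<open>(l - L\<^sub>\<epsilon>) u \<ge> 1\<close>. They form an open, upward closed set. At values decreasing to its infimum, monotone
  iteration gives solutions of \<open>(l - L\<^sub>\<epsilon>) w = 1\<close>, which must be unbounded because the infimum is not
  attained; normalised and passed to a limit by Arzela-Ascoli, they give an eigenfunction at the
  infimum. Sturm comparison with a sine on an interval where \<open>c > max c - \<delta> / 2\<close> shows that the infimum
  is at least \<open>max c - \<delta>\<close> once \<open>\<epsilon>\<close> is small.
\<close>

subsection \<open>Periodic functions\<close>

text \<open>\<open>y + frac (x - y)\<close> is the representative of \<open>x\<close> in the
  fundamental domain \<open>[y, y + 1)\<close>. The case \<open>y = 0\<close> brings in compactness
  of \<open>{0..1}\<close>; general \<open>y\<close> moves any point to within distance one of a
  chosen base point.\<close>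

lemma periodic_frac:
  fixes f :: "real \<Rightarrow> 'a"
  assumes "periodic_fun_simple' f"
  shows "f (y + frac (x - y)) = f x"
proof -
  interpret periodic_fun_simple' f by fact
  have "f (x - of_int \<lfloor>x - y\<rfloor>) = f x" by (rule minus_of_int)
  moreover have "y + frac (x - y) = x - of_int \<lfloor>x - y\<rfloor>" by (simp add: frac_def)
  ultimately show ?thesis by simp
qed

lemma periodic_attains_max:
  fixes f :: "real \<Rightarrow> real"
  assumes "periodic_fun_simple' f" "continuous_on UNIV f"
  obtains x0 where "\<And>x. f x \<le> f x0"
proof -
  have "continuous_on {0..1} f" using assms(2) continuous_on_subset by blast
  then obtain x0 where x0: "\<forall>y\<in>{0..1}. f y \<le> f x0"
    using continuous_attains_sup[of "{0..1::real}" f] by auto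
  have "f x \<le> f x0" for x
  proof -
    have "frac x \<in> {0..1}" using frac_lt_1[of x] by (auto intro: less_imp_le)
    then show ?thesis using x0 periodic_frac[OF assms(1), of 0 x] by fastforce
  qed
  then show thesis using that by blast
qed

lemma periodic_attains_min:
  fixes f :: "real \<Rightarrow> real"
  assumes "periodic_fun_simple' f" "continuous_on UNIV f"
  obtains x0 where "\<And>x. f x0 \<le> f x"
proof -
  have "periodic_fun_simple' (\<lambda>x. - f x)" "continuous_on UNIV (\<lambda>x. - f x)"
    using assms by (auto simp: periodic_fun_simple'_def intro!: continuous_intros)
  then show thesis using periodic_attains_max that by (metis neg_le_iff_le)
qed

text \<open>For \<open>y \<le> z \<le> y + 1\<close> monotonicity squeezes \<open>g z\<close>
  between \<open>g y\<close> and \<open>g (y + 1) = g y\<close>, so \<open>g\<close> is locally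
  constant. This stands in for integrating \<open>g'\<close> over the circle.\<close>

lemma periodic_mono_imp_deriv_zero:
  fixes g :: "real \<Rightarrow> real"
  assumes "periodic_fun_simple' g"
    and d: "\<And>x. (g has_real_derivative g' x) (at x)" and nn: "\<And>x. 0 \<le> g' x"
  shows "g' x = 0"
proof -
  interpret periodic_fun_simple' g by fact
  have mono: "g y \<le> g z" if "y \<le> z" for y z
    using DERIV_nonneg_imp_nondecreasing[OF that] d nn by blast
  have eq: "g y = g z" if "y \<le> z" "z \<le> y + 1" for y z
    using mono[OF that(1)] mono[OF that(2)] plus_1[of y] by simp
  have "g x = g y" if "\<bar>x - y\<bar> < 1" for y
  proof (cases "x \<le> y")
    case True
    then show ?thesis using eq[of x y] that by linarith
  next
    case False
    then show ?thesis using eq[of y x] that by linarith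
  qed
  then show ?thesis using DERIV_local_const[OF d[of x], of 1] by simp
qed

text \<open>If \<open>l < 0\<close>, then \<open>w1\<close> is negative just to the right of its
  zero \<open>x0\<close>, and the mean value theorem produces a value of \<open>w\<close> below the
  minimum. Only the derivative of \<open>w1\<close> at \<open>x0\<close> enters, with no continuity
  of a second derivative.\<close>

lemma second_derivative_nonneg_at_min:
  fixes w :: "real \<Rightarrow> real"
  assumes d1: "\<And>x. (w has_real_derivative w1 x) (at x)"
    and d2: "(w1 has_real_derivative l) (at x0)" and min: "\<And>x. w x0 \<le> w x"
  shows "0 \<le> l"
proof (rule ccontr)
  assume "\<not> 0 \<le> l"
  then obtain d where d: "d > 0" "\<And>h. h > 0 \<Longrightarrow> h < d \<Longrightarrow> w1 (x0 + h) < w1 x0"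
    using DERIV_neg_dec_right[OF d2] by auto
  have "w1 x0 = 0" using DERIV_local_min[OF d1[of x0], of 1] min by simp
  obtain z where z: "x0 < z" "z < x0 + d / 2" "w (x0 + d / 2) - w x0 = (x0 + d / 2 - x0) * w1 z"
    using MVT2[of x0 "x0 + d / 2" w w1] d1 d(1) by auto
  have "w1 z < 0" using d(2)[of "z - x0"] z \<open>w1 x0 = 0\<close> d(1) by simp
  then have "(x0 + d / 2 - x0) * w1 z < 0" using d(1) by (simp add: mult_pos_neg)
  then show False using z(3) min[of "x0 + d / 2"] by linarith
qed

text \<open>Variation of constants: \<open>exp (k * x) * (F x - c0)\<close> solves the equation for
  every \<open>c0\<close> when \<open>F\<close> is an antiderivative of
  \<open>exp (- k * x) * f x\<close>. Periodicity fixes \<open>c0\<close>, and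
  \<open>k \<noteq> 0\<close> makes the condition on \<open>c0\<close> solvable.\<close>

lemma first_order_periodic_solution:
  fixes f :: "real \<Rightarrow> real"
  assumes per: "periodic_fun_simple' f" and cont: "continuous_on UNIV f" and "k \<noteq> 0"
  obtains v where "periodic_fun_simple' v"
    "\<And>x. (v has_real_derivative k * v x + f x) (at x)"
proof -
  have "isCont (\<lambda>t. exp (- k * t) * f t) x" for x
    using cont by (auto simp: continuous_on_eq_continuous_at intro!: continuous_intros)
  then obtain F where F: "\<And>x. (F has_real_derivative exp (- k * x) * f x) (at x)"
    using einterval_antiderivative[of "-\<infinity>" "\<infinity>" "\<lambda>t. exp (- k * t) * f t"]
    by (auto simp: has_real_derivative_iff_has_vector_derivative)
  define H where "H = (\<lambda>x. F (x + 1) - exp (- k) * F x)"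
  have "(H has_real_derivative 0) (at x)" for x
  proof -
    have "((\<lambda>x. F (x + 1)) has_real_derivative exp (- k * (x + 1)) * f (x + 1)) (at x)"
      using F[of "x + 1"] by (subst DERIV_shift [symmetric]) simp
    then have "(H has_real_derivative exp (- k * (x + 1)) * f (x + 1) - exp (- k) * (exp (- k * x) * f x)) (at x)"
      unfolding H_def by (intro DERIV_diff DERIV_cmult F)
    moreover have "f (x + 1) = f x" using per by (simp add: periodic_fun_simple'_def)
    moreover have "exp (- k * (x + 1)) = exp (- k) * exp (- k * x)"
      by (simp add: exp_add[symmetric] algebra_simps)
    ultimately show ?thesis by simp
  qed
  then have H: "H x = H 0" for x using DERIV_isconst_all[of H] by metis
  \<comment> \<open>The fixed point of the affine relation
    \<open>F (x + 1) = exp (- k) * F x + H 0\<close>: with it, \<open>F - c0\<close> is merely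
    multiplied by \<open>exp (- k)\<close> over a period, which cancels the growth of
    \<open>exp (k * x)\<close>.\<close>
  define c0 where "c0 = H 0 / (1 - exp (- k))"
  have ne: "1 - exp (- k) \<noteq> 0" using \<open>k \<noteq> 0\<close> by simp
  have "H 0 = c0 * (1 - exp (- k))" using ne by (simp add: c0_def)
  then have shift: "F (x + 1) - c0 = exp (- k) * (F x - c0)" for x
    using H[of x] unfolding H_def by (simp add: algebra_simps)
  define v where "v = (\<lambda>x. exp (k * x) * (F x - c0))"
  have "v (x + 1) = v x" for x
  proof -
    have "exp (k * (x + 1)) * exp (- k) = exp (k * x)"
      by (simp add: exp_add[symmetric] algebra_simps)
    then show ?thesis unfolding v_def shift by (simp add: mult.assoc[symmetric])
  qed
  moreover have "(v has_real_derivative k * v x + f x) (at x)" for x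
  proof -
    have "exp (k * x) * (exp (- k * x) * f x) = f x"
      by (simp add: mult.assoc[symmetric] exp_add[symmetric])
    then show ?thesis
      unfolding v_def by (auto intro!: derivative_eq_intros F simp: algebra_simps)
  qed
  ultimately show thesis using that[of v] by (simp add: periodic_fun_simple'_def)
qed

subsection \<open>The inverse of \<open>k\<^sup>2 - d\<^sup>2/dx\<^sup>2\<close> on the circle\<close>

text \<open>The source \<open>h\<close> may be any function, not just a continuous one, so that a
  supersolution with an arbitrary second derivative \<open>u2\<close> fits as well, with
  \<open>h = k\<^sup>2 u - u2\<close>.\<close>

definition helmholtz :: "real \<Rightarrow> (real \<Rightarrow> real) \<Rightarrow> (real \<Rightarrow> real) \<Rightarrow> bool" where
  "helmholtz k h w \<longleftrightarrow> periodic_fun_simple' w \<and>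
     (\<exists>w1. \<forall>x. (w has_real_derivative w1 x) (at x) \<and>
        (w1 has_real_derivative k\<^sup>2 * w x - h x) (at x))"

lemma helmholtz_periodic: "helmholtz k h w \<Longrightarrow> periodic_fun_simple' w"
  by (simp add: helmholtz_def)

lemma helmholtz_continuous: "helmholtz k h w \<Longrightarrow> continuous_on UNIV w"
  unfolding helmholtz_def by (meson DERIV_isCont continuous_at_imp_continuous_on)

text \<open>Factorisation into first-order operators: with D the derivative, solving
  \<open>(D - k) v = - h\<close> and then \<open>(D + k) w = v\<close> gives
  \<open>D\<^sup>2 w - k\<^sup>2 w = - h\<close>.\<close>

lemma helmholtz_exists:
  assumes "periodic_fun_simple' h" "continuous_on UNIV h" "k \<noteq> 0"
  obtains w where "helmholtz k h w"
proof -
  have "periodic_fun_simple' (\<lambda>x. - h x)" "continuous_on UNIV (\<lambda>x. - h x)"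
    using assms by (auto simp: periodic_fun_simple'_def intro!: continuous_intros)
  then obtain v where v: "periodic_fun_simple' v"
    "\<And>x. (v has_real_derivative k * v x + - h x) (at x)"
    using first_order_periodic_solution \<open>k \<noteq> 0\<close> by blast
  have "continuous_on UNIV v"
    using v(2) by (meson DERIV_isCont continuous_at_imp_continuous_on)
  then obtain w where w: "periodic_fun_simple' w"
    "\<And>x. (w has_real_derivative - k * w x + v x) (at x)"
    using first_order_periodic_solution[OF v(1), of "- k"] \<open>k \<noteq> 0\<close> by auto
  have "((\<lambda>x. - k * w x + v x) has_real_derivative k\<^sup>2 * w x - h x) (at x)" for x
    by (rule derivative_eq_intros v w refl)+ (simp add: algebra_simps power2_eq_square)
  then have "helmholtz k h w"
    unfolding helmholtz_def using w by (intro conjI exI[of _ "\<lambda>x. - k * w x + v x"]) auto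
  then show thesis by (rule that)
qed

lemma helmholtz_diff:
  assumes "helmholtz k h w" "helmholtz k h' w'"
  shows "helmholtz k (\<lambda>x. h x - h' x) (\<lambda>x. w x - w' x)"
proof -
  obtain a b where a: "\<And>x. (w has_real_derivative a x) (at x)"
      "\<And>x. (a has_real_derivative k\<^sup>2 * w x - h x) (at x)"
    and b: "\<And>x. (w' has_real_derivative b x) (at x)"
      "\<And>x. (b has_real_derivative k\<^sup>2 * w' x - h' x) (at x)"
    using assms unfolding helmholtz_def by metis
  have "((\<lambda>x. w x - w' x) has_real_derivative a x - b x) (at x) \<and>
      ((\<lambda>x. a x - b x) has_real_derivative k\<^sup>2 * (w x - w' x) - (h x - h' x)) (at x)" for x
    by (auto intro!: derivative_eq_intros a b simp: algebra_simps)
  moreover have "periodic_fun_simple' (\<lambda>x. w x - w' x)"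
    using assms by (simp add: helmholtz_def periodic_fun_simple'_def)
  ultimately show ?thesis
    unfolding helmholtz_def by (intro conjI exI[of _ "\<lambda>x. a x - b x"]) auto
qed

lemma helmholtz_cmult:
  assumes "helmholtz k h w"
  shows "helmholtz k (\<lambda>x. s * h x) (\<lambda>x. s * w x)"
proof -
  obtain a where a: "\<And>x. (w has_real_derivative a x) (at x)"
      "\<And>x. (a has_real_derivative k\<^sup>2 * w x - h x) (at x)"
    using assms unfolding helmholtz_def by metis
  have "((\<lambda>x. s * w x) has_real_derivative s * a x) (at x) \<and>
      ((\<lambda>x. s * a x) has_real_derivative k\<^sup>2 * (s * w x) - s * h x) (at x)" for x
    using DERIV_cmult[OF a(1), of s x] DERIV_cmult[OF a(2), of s x] by (simp add: algebra_simps)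
  moreover have "periodic_fun_simple' (\<lambda>x. s * w x)"
    using assms by (simp add: helmholtz_def periodic_fun_simple'_def)
  ultimately show ?thesis
    unfolding helmholtz_def by (intro conjI exI[of _ "\<lambda>x. s * a x"]) auto
qed

lemma helmholtz_const: "k \<noteq> 0 \<Longrightarrow> helmholtz k (\<lambda>x. C) (\<lambda>x. C / k\<^sup>2)"
  unfolding helmholtz_def periodic_fun_simple'_def
  by (auto intro!: exI[of _ "\<lambda>x. 0"])

text \<open>The second derivative \<open>k\<^sup>2 * w - h\<close> is nonnegative at a minimum of
  \<open>w\<close>. This is the maximum principle behind the comparison results that follow.\<close>

lemma helmholtz_min:
  assumes "helmholtz k h w"
  obtains x0 where "\<And>x. w x0 \<le> w x" "h x0 \<le> k\<^sup>2 * w x0"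
proof -
  obtain a where a: "\<And>x. (w has_real_derivative a x) (at x)"
      "\<And>x. (a has_real_derivative k\<^sup>2 * w x - h x) (at x)"
    using assms unfolding helmholtz_def by metis
  obtain x0 where x0: "\<And>x. w x0 \<le> w x"
    using periodic_attains_min[OF helmholtz_periodic helmholtz_continuous] assms by metis
  show thesis
    using that[OF x0] second_derivative_nonneg_at_min[OF a(1) a(2)[of x0] x0] by simp
qed

lemma helmholtz_nonneg:
  assumes "helmholtz k h w" "\<And>x. 0 \<le> h x" "k \<noteq> 0"
  shows "0 \<le> w x"
proof -
  obtain x0 where x0: "\<And>x. w x0 \<le> w x" "h x0 \<le> k\<^sup>2 * w x0"
    using helmholtz_min[OF assms(1)] by blast
  then have "0 \<le> k\<^sup>2 * w x0" using assms(2)[of x0] by linarith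
  then have "0 \<le> w x0" using \<open>k \<noteq> 0\<close> by (simp add: zero_le_mult_iff)
  then show ?thesis using x0(1)[of x] by linarith
qed

lemma helmholtz_mono:
  assumes "helmholtz k h w" "helmholtz k h' w'" "\<And>x. h x \<le> h' x" "k \<noteq> 0"
  shows "w x \<le> w' x"
  using helmholtz_nonneg[OF helmholtz_diff[OF assms(2,1)]] assms(3,4) by simp

lemma helmholtz_bound:
  assumes "helmholtz k h w" "\<And>x. \<bar>h x\<bar> \<le> C" "k \<noteq> 0"
  shows "\<bar>w x\<bar> \<le> C / k\<^sup>2"
proof -
  have "h y \<le> C" "- C \<le> h y" for y using assms(2)[of y] by linarith+
  then have "w x \<le> C / k\<^sup>2" "- C / k\<^sup>2 \<le> w x"
    using helmholtz_mono[OF assms(1) helmholtz_const[of k C]]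
      helmholtz_mono[OF helmholtz_const[of k "- C"] assms(1)] \<open>k \<noteq> 0\<close> by auto
  then show ?thesis by linarith
qed

text \<open>The equation bounds the second derivative by \<open>2 * C\<close>. The first derivative
  vanishes at a maximum \<open>z\<close> of \<open>w\<close>, and by periodicity every point can be
  moved to within distance one of \<open>z\<close>, so the first derivative is also bounded by
  \<open>2 * C\<close>.\<close>

lemma helmholtz_lipschitz:
  assumes w: "helmholtz k h w" and C: "\<And>x. \<bar>h x\<bar> \<le> C" and "k \<noteq> 0"
  shows "\<bar>w x - w y\<bar> \<le> 2 * C * \<bar>x - y\<bar>"
proof -
  obtain a where a: "\<And>x. (w has_real_derivative a x) (at x)"
      "\<And>x. (a has_real_derivative k\<^sup>2 * w x - h x) (at x)"
    using w unfolding helmholtz_def by metis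
  obtain z where "\<And>x. w x \<le> w z"
    using periodic_attains_max[OF helmholtz_periodic helmholtz_continuous] w by metis
  then have "a z = 0" using DERIV_local_max[OF a(1)[of z], of 1] by simp
  have "\<bar>k\<^sup>2 * w x - h x\<bar> \<le> 2 * C" for x
  proof -
    have "\<bar>k\<^sup>2 * w x\<bar> \<le> C"
      using helmholtz_bound[OF assms, of x] \<open>k \<noteq> 0\<close> by (simp add: abs_mult field_simps)
    then show ?thesis using C[of x] by linarith
  qed
  then have lip: "\<bar>a s - a t\<bar> \<le> 2 * C * \<bar>s - t\<bar>" for s t
    using field_differentiable_bound[of UNIV a "\<lambda>x. k\<^sup>2 * w x - h x" "2 * C" s t] a(2)
    by auto
  have "0 \<le> C" using C[of 0] by linarith
  interpret periodic_fun_simple' w using w by (rule helmholtz_periodic)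
  have "a (x + 1) = a x" for x
  proof -
    have "((\<lambda>x. w (x + 1)) has_real_derivative a (x + 1)) (at x)"
      using a(1)[of "x + 1"] by (subst DERIV_shift [symmetric]) simp
    then show ?thesis using DERIV_unique a(1)[of x] by (simp add: plus_1)
  qed
  then have "periodic_fun_simple' a" by (simp add: periodic_fun_simple'_def)
  then have "a s = a (z + frac (s - z))" for s by (simp add: periodic_frac)
  moreover have "\<bar>a (z + frac (s - z))\<bar> \<le> 2 * C" for s
  proof -
    have "2 * C * frac (s - z) \<le> 2 * C * 1"
      using \<open>0 \<le> C\<close> frac_lt_1[of "s - z"] by (intro mult_left_mono) auto
    then show ?thesis using lip[of "z + frac (s - z)" z] \<open>a z = 0\<close> by (simp add: abs_of_nonneg)
  qed
  ultimately have "\<bar>a s\<bar> \<le> 2 * C" for s by metis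
  then show ?thesis
    using field_differentiable_bound[of UNIV w a "2 * C" x y] a(1) by auto
qed

section \<open>Compactness and passage to the limit in the Helmholtz equation\<close>

text \<open>A common bound on the sources makes the solutions uniformly bounded and equi-Lipschitz;
  Arzela-Ascoli on \<open>{0..1}\<close> gives a uniform limit there, and periodicity spreads it
  over the line.\<close>

lemma helmholtz_compact:
  assumes w: "\<And>n. helmholtz k (h n) (w n)" and C: "\<And>n x. \<bar>h n x\<bar> \<le> C" and "k \<noteq> 0"
  obtains s u where "strict_mono (s :: nat \<Rightarrow> nat)" "uniform_limit UNIV (\<lambda>n. w (s n)) u sequentially"
proof -
  have 1: "norm (w n x) \<le> C / k\<^sup>2" for n x using helmholtz_bound[OF w C \<open>k \<noteq> 0\<close>] by simp
  have "0 \<le> C" using C[of 0 0] by linarith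
  have 2: "\<exists>d>0. \<forall>n y. y \<in> {0..1::real} \<and> norm (x - y) < d \<longrightarrow> norm (w n x - w n y) < e"
    if "e > 0" for x e
  proof (intro exI conjI allI impI)
    \<comment> \<open>The added one keeps the radius meaningful when \<open>C = 0\<close>.\<close>
    show "0 < e / (2 * C + 1)" using \<open>0 \<le> C\<close> \<open>e > 0\<close> by simp
    fix n y assume "y \<in> {0..1} \<and> norm (x - y) < e / (2 * C + 1)"
    then have "(2 * C + 1) * \<bar>x - y\<bar> < e" using \<open>0 \<le> C\<close> by (simp add: field_simps)
    moreover have "\<bar>w n x - w n y\<bar> \<le> 2 * C * \<bar>x - y\<bar>"
      by (rule helmholtz_lipschitz[OF w C \<open>k \<noteq> 0\<close>])
    ultimately show "norm (w n x - w n y) < e" by (simp add: algebra_simps)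
  qed
  obtain g s where g: "strict_mono (s :: nat \<Rightarrow> nat)"
    "\<And>e. 0 < e \<Longrightarrow> \<exists>N. \<forall>n x. n \<ge> N \<and> x \<in> {0..1} \<longrightarrow> norm (w (s n) x - g x) < e"
    using Arzela_Ascoli[of "{0..1::real}" w "C / k\<^sup>2"] 1 2 by (metis compact_Icc)
  have "uniform_limit UNIV (\<lambda>n. w (s n)) (\<lambda>x. g (frac x)) sequentially"
  proof (rule uniform_limitI)
    fix e :: real assume "0 < e"
    then obtain N where N: "\<And>n x. n \<ge> N \<Longrightarrow> x \<in> {0..1} \<Longrightarrow> norm (w (s n) x - g x) < e" using g(2) by meson
    have "dist (w (s n) x) (g (frac x)) < e" if "n \<ge> N" for n x
    proof -
      have "frac x \<in> {0..1}" using frac_lt_1[of x] by (auto intro: less_imp_le)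
      moreover have "w (s n) (frac x) = w (s n) x"
        using periodic_frac[OF helmholtz_periodic[OF w], of "s n" 0 x] by simp
      ultimately show ?thesis using N[OF that, of "frac x"] by (simp add: dist_norm)
    qed
    then show "\<forall>\<^sub>F n in sequentially. \<forall>x\<in>UNIV. dist (w (s n) x) (g (frac x)) < e"
      unfolding eventually_sequentially by blast
  qed
  then show thesis using that g(1) by blast
qed

text \<open>No derivatives are passed to the limit. The solution \<open>v\<close> for the limiting
  source exists, and the sup bound applied to \<open>w n - v\<close> shows that \<open>w n\<close>
  tends to \<open>v\<close>, so \<open>u = v\<close>.\<close>

lemma helmholtz_limit:
  assumes w: "\<And>n. helmholtz k (h n) (w n)" and "k \<noteq> 0"
    and h: "uniform_limit UNIV h h' sequentially"
    and per: "periodic_fun_simple' h'" and cont: "continuous_on UNIV h'"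
    and u: "\<And>x. (\<lambda>n. w n x) \<longlonglongrightarrow> u x"
  shows "helmholtz k h' u"
proof -
  obtain v where v: "helmholtz k h' v" using helmholtz_exists[OF per cont \<open>k \<noteq> 0\<close>] .
  have "(\<lambda>n. w n x) \<longlonglongrightarrow> v x" for x
  proof (rule tendstoI)
    fix e :: real assume "0 < e"
    then have "0 < e * k\<^sup>2 / 2" using \<open>k \<noteq> 0\<close> by simp
    from uniform_limitD[OF h this] show "\<forall>\<^sub>F n in sequentially. dist (w n x) (v x) < e"
    proof eventually_elim
      case (elim n)
      then have "\<And>y. \<bar>h n y - h' y\<bar> \<le> e * k\<^sup>2 / 2" by (auto simp: dist_real_def intro: less_imp_le)
      from helmholtz_bound[OF helmholtz_diff[OF w v] this \<open>k \<noteq> 0\<close>, of x]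
      show ?case using \<open>0 < e\<close> \<open>k \<noteq> 0\<close> by (simp add: dist_real_def)
    qed
  qed
  then have "u = v" using u LIMSEQ_unique by blast
  then show ?thesis using v by simp
qed

lemma uniform_limit_periodic:
  assumes "uniform_limit UNIV f g sequentially" "\<And>n::nat. periodic_fun_simple' (f n :: real \<Rightarrow> real)"
  shows "periodic_fun_simple' g"
proof
  fix x
  have "(\<lambda>n. f n (x + 1)) \<longlonglongrightarrow> g (x + 1)" "(\<lambda>n. f n x) \<longlonglongrightarrow> g x"
    using tendsto_uniform_limitI[OF assms(1)] by auto
  moreover have "f n (x + 1) = f n x" for n using assms(2)[of n] by (simp add: periodic_fun_simple'_def)
  ultimately show "g (x + 1) = g x" using LIMSEQ_unique by auto
qed

section \<open>Monotone iteration\<close>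

text \<open>Starting from zero, repeatedly solve with source \<open>p * v + r\<close>. Since
  \<open>p \<ge> 0\<close>, comparison makes the iterates increase and keeps them below
  \<open>U\<close>; compactness then gives a limit, which is a fixed point.\<close>

lemma helmholtz_solution_below_supersolution:
  fixes p r :: "real \<Rightarrow> real"
  assumes p: "periodic_fun_simple' p" "continuous_on UNIV p" "\<And>x. 0 \<le> p x"
    and r: "periodic_fun_simple' r" "continuous_on UNIV r" "\<And>x. 0 \<le> r x"
    and U: "helmholtz k h U" "\<And>x. 0 \<le> U x" "\<And>x. p x * U x + r x \<le> h x" and "k \<noteq> 0"
  obtains u where "helmholtz k (\<lambda>x. p x * u x + r x) u" "\<And>x. 0 \<le> u x"
proof -
  define rhs where "rhs = (\<lambda>u x. p x * u x + r x)"
  \<comment> \<open>The choice is known to be a solution only for periodic continuous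
    \<open>u\<close>, so both properties are carried along the iteration.\<close>
  define T where "T = (\<lambda>u. SOME w. helmholtz k (rhs u) w)"
  define v where "v = (\<lambda>n. (T ^^ n) (\<lambda>x. 0))"
  have rhs_per: "periodic_fun_simple' (rhs u)" if "periodic_fun_simple' u" for u
    using p(1) r(1) that by (simp add: rhs_def periodic_fun_simple'_def)
  have rhs_cont: "continuous_on UNIV (rhs u)" if "continuous_on UNIV u" for u
    unfolding rhs_def using p(2) r(2) that by (intro continuous_intros)
  have T: "helmholtz k (rhs u) (T u)" if "periodic_fun_simple' u" "continuous_on UNIV u" for u
    unfolding T_def
    using helmholtz_exists[OF rhs_per rhs_cont \<open>k \<noteq> 0\<close>] that by (metis someI_ex)
  have v_reg: "periodic_fun_simple' (v n)" "continuous_on UNIV (v n)" for n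
  proof (induction n)
    case 0
    show "periodic_fun_simple' (v 0)" "continuous_on UNIV (v 0)"
      by (auto simp: v_def periodic_fun_simple'_def)
  next
    case (Suc n)
    show "periodic_fun_simple' (v (Suc n))" "continuous_on UNIV (v (Suc n))"
      using T[OF Suc] helmholtz_periodic helmholtz_continuous by (auto simp: v_def)
  qed
  have v_Suc: "helmholtz k (rhs (v n)) (v (Suc n))" for n
    using T[OF v_reg] by (simp add: v_def)
  have v_mono: "0 \<le> v n x \<and> v n x \<le> v (Suc n) x" for n x
  proof (induction n arbitrary: x)
    case 0
    show ?case using helmholtz_nonneg[OF v_Suc[of 0] _ \<open>k \<noteq> 0\<close>] r(3) by (simp add: v_def rhs_def)
  next
    case (Suc n)
    have "rhs (v n) y \<le> rhs (v (Suc n)) y" for y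
      using Suc[of y] p(3)[of y] by (simp add: rhs_def mult_left_mono)
    from helmholtz_mono[OF v_Suc v_Suc this \<open>k \<noteq> 0\<close>] Suc[of x] show ?case by (meson order.trans)
  qed
  have v_le: "v n x \<le> U x" for n x
  proof (induction n arbitrary: x)
    case 0
    show ?case using U(2) by (simp add: v_def)
  next
    case (Suc n)
    have "rhs (v n) y \<le> h y" for y
    proof -
      have "p y * v n y \<le> p y * U y" using Suc[of y] p(3)[of y] by (rule mult_left_mono)
      then show ?thesis using U(3)[of y] by (simp add: rhs_def)
    qed
    from helmholtz_mono[OF v_Suc U(1) this \<open>k \<noteq> 0\<close>] show ?case .
  qed
  obtain xh where xh: "\<And>x. rhs U x \<le> rhs U xh"
    using periodic_attains_max rhs_per rhs_cont U(1) helmholtz_periodic helmholtz_continuous by metis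
  have bound: "\<bar>rhs (v n) x\<bar> \<le> rhs U xh" for n x
  proof -
    have "p x * v n x \<le> p x * U x" using v_le p(3) by (rule mult_left_mono)
    then have "rhs (v n) x \<le> rhs U xh" using xh[of x] by (simp add: rhs_def)
    moreover have "0 \<le> rhs (v n) x" using v_mono p(3) r(3) by (simp add: rhs_def)
    ultimately show ?thesis by simp
  qed
  obtain s u where s: "strict_mono s" "uniform_limit UNIV (\<lambda>n. v (Suc (s n))) u sequentially"
    by (rule helmholtz_compact[of k "\<lambda>n. rhs (v n)" "\<lambda>n. v (Suc n)", OF v_Suc bound \<open>k \<noteq> 0\<close>])
  have su: "(\<lambda>n. v (Suc (s n)) x) \<longlonglongrightarrow> u x" for x
    using tendsto_uniform_limitI[OF s(2)] by auto
  have inc: "incseq (\<lambda>n. v n x)" for x using v_mono by (intro incseq_SucI) blast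
  have le_u: "v n x \<le> u x" for n x
  proof -
    have "v n x \<le> v (Suc (s m)) x" if "n \<le> m" for m
      using incseqD[OF inc, of n "Suc (s m)" x] seq_suble[OF s(1), of m] that by simp
    then show ?thesis
      using LIMSEQ_le_const[OF su, of "v n x"] by blast
  qed
  have u: "periodic_fun_simple' u" "continuous_on UNIV u"
    using uniform_limit_periodic[OF s(2)] v_reg uniform_limit_theorem[OF _ s(2)] by auto
  obtain xp where xp: "\<And>x. p x \<le> p xp" using periodic_attains_max p(1,2) by metis
  text \<open>The iterates increase, so the shifted sequence converges along the same indices.\<close>
  have "uniform_limit UNIV (\<lambda>n. rhs (v (Suc (s n)))) (rhs u) sequentially"
  proof (rule uniform_limitI)
    fix e :: real assume "0 < e"
    have "0 \<le> p xp" using p(3) .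
    then have "0 < e / (p xp + 1)" using \<open>0 < e\<close> by simp
    from uniform_limitD[OF s(2) this]
    show "\<forall>\<^sub>F n in sequentially. \<forall>x\<in>UNIV. dist (rhs (v (Suc (s n))) x) (rhs u x) < e"
    proof eventually_elim
      case (elim n)
      show ?case
      proof
        fix x
        have "\<bar>v (Suc (s n)) x - u x\<bar> < e / (p xp + 1)" using elim by (simp add: dist_real_def)
        then have "(p xp + 1) * \<bar>v (Suc (s n)) x - u x\<bar> < e" using \<open>0 \<le> p xp\<close> by (simp add: field_simps)
        moreover have "p x * \<bar>v (Suc (s n)) x - u x\<bar> \<le> (p xp + 1) * \<bar>v (Suc (s n)) x - u x\<bar>"
          using xp[of x] by (intro mult_right_mono) auto
        moreover have "rhs (v (Suc (s n))) x - rhs u x = p x * (v (Suc (s n)) x - u x)"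
          by (simp add: rhs_def algebra_simps)
        ultimately show "dist (rhs (v (Suc (s n))) x) (rhs u x) < e"
          using p(3)[of x] by (simp add: dist_real_def abs_mult)
      qed
    qed
  qed
  moreover have "(\<lambda>n. v (Suc (Suc (s n))) x) \<longlonglongrightarrow> u x" for x
  proof (rule real_tendsto_sandwich[OF _ _ su tendsto_const])
    show "\<forall>\<^sub>F n in sequentially. v (Suc (s n)) x \<le> v (Suc (Suc (s n))) x"
      using v_mono by simp
    show "\<forall>\<^sub>F n in sequentially. v (Suc (Suc (s n))) x \<le> u x"
      using le_u by simp
  qed
  ultimately have "helmholtz k (rhs u) u"
    using helmholtz_limit[of k "\<lambda>n. rhs (v (Suc (s n)))" "\<lambda>n. v (Suc (Suc (s n)))"]
      v_Suc \<open>k \<noteq> 0\<close> rhs_per rhs_cont u by blast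
  moreover have "0 \<le> u x" for x using le_u[of 0 x] by (simp add: v_def)
  ultimately show thesis using that unfolding rhs_def by blast
qed

subsection \<open>Supersolutions and the eigenfunction at the infimum\<close>

locale circle_coefficients =
  fixes c r :: "real \<Rightarrow> real"
  assumes c_periodic: "periodic_fun_simple' c" and c_continuous: "continuous_on UNIV c"
    and r_periodic: "periodic_fun_simple' r" and r_continuous: "continuous_on UNIV r"
    and r_pos: "0 < r x"
begin

text \<open>With \<open>r = 1 / (\<epsilon> a)\<close> the differential inequality reads \<open>(l - L\<^sub>\<epsilon>) u \<ge> 1\<close>.\<close>

definition supersolution :: "real \<Rightarrow> (real \<Rightarrow> real) \<Rightarrow> bool" where
  "supersolution l u \<longleftrightarrow> periodic_fun_simple' u \<and> (\<forall>x. 0 < u x) \<and>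
     (\<exists>u1 u2. \<forall>x. (u has_real_derivative u1 x) (at x) \<and> (u1 has_real_derivative u2 x) (at x) \<and>
        u2 x \<le> ((l - c x) * u x - 1) * r x)"

lemma supersolution_continuous: "supersolution l u \<Longrightarrow> continuous_on UNIV u"
  unfolding supersolution_def by (meson DERIV_isCont continuous_at_imp_continuous_on)

lemma supersolution_mono:
  assumes "supersolution l u" "l \<le> l'"
  shows "supersolution l' u"
proof -
  obtain u1 u2 where u: "\<And>x. (u has_real_derivative u1 x) (at x)"
    "\<And>x. (u1 has_real_derivative u2 x) (at x)" "\<And>x. u2 x \<le> ((l - c x) * u x - 1) * r x"
    and pos: "\<And>x. 0 < u x" and per: "periodic_fun_simple' u"
    using assms(1) unfolding supersolution_def by metis
  have "u2 x \<le> ((l' - c x) * u x - 1) * r x" for x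
  proof -
    have "(l - c x) * u x \<le> (l' - c x) * u x"
      using assms(2) pos[of x] by (intro mult_right_mono) auto
    then have "((l - c x) * u x - 1) * r x \<le> ((l' - c x) * u x - 1) * r x"
      using r_pos[of x] by (intro mult_right_mono) auto
    then show ?thesis using u(3)[of x] by linarith
  qed
  then show ?thesis unfolding supersolution_def using u(1,2) pos per by blast
qed

text \<open>Doubling \<open>u\<close> raises the lower bound from 1 to 2, and lowering the value by
  \<open>t\<close> costs \<open>2 * t * u \<le> 1\<close>, so the bound 1 survives. This yields both
  openness of the set of admissible values and blow-up at its infimum.\<close>

lemma supersolution_lower:
  assumes "supersolution (l + t) u" and small: "\<And>x. t * u x \<le> 1 / 2"
  shows "supersolution l (\<lambda>x. 2 * u x)"
proof -
  obtain u1 u2 where u: "\<And>x. (u has_real_derivative u1 x) (at x)"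
    "\<And>x. (u1 has_real_derivative u2 x) (at x)" "\<And>x. u2 x \<le> ((l + t - c x) * u x - 1) * r x"
    and pos: "\<And>x. 0 < u x" and per: "periodic_fun_simple' u"
    using assms(1) unfolding supersolution_def by metis
  have "2 * u2 x \<le> ((l - c x) * (2 * u x) - 1) * r x" for x
  proof -
    have "2 * ((l + t - c x) * u x - 1) \<le> (l - c x) * (2 * u x) - 1"
      using small[of x] by (simp add: algebra_simps)
    then have "2 * ((l + t - c x) * u x - 1) * r x \<le> ((l - c x) * (2 * u x) - 1) * r x"
      using r_pos[of x] by (intro mult_right_mono) auto
    then show ?thesis using u(3)[of x] by linarith
  qed
  moreover have "periodic_fun_simple' (\<lambda>x. 2 * u x)"
    using per by (simp add: periodic_fun_simple'_def)
  ultimately show ?thesis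
    unfolding supersolution_def using pos DERIV_cmult[OF u(1)] DERIV_cmult[OF u(2)]
    by (intro conjI exI[of _ "\<lambda>x. 2 * u1 x"] exI[of _ "\<lambda>x. 2 * u2 x"]) auto
qed

lemma supersolution_exists: "\<exists>l u. supersolution l u"
proof -
  obtain x0 where x0: "\<And>x. c x \<le> c x0" using periodic_attains_max c_periodic c_continuous by metis
  have "supersolution (c x0 + 1) (\<lambda>x. 1)"
    unfolding supersolution_def
    using x0 r_pos
    by (auto intro!: exI[of _ "\<lambda>x. 0"] simp: periodic_fun_simple'_def less_imp_le)
  then show ?thesis by blast
qed

text \<open>Adding \<open>k\<^sup>2 u\<close> to both sides of the differential inequality. For
  large \<open>k\<close> the coefficient \<open>k\<^sup>2 - (l - c x) * r x\<close> is nonnegative,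
  as monotone iteration demands.\<close>

lemma supersolution_iff_helmholtz:
  "supersolution l u \<longleftrightarrow> (\<forall>x. 0 < u x) \<and>
     (\<exists>h. helmholtz k h u \<and> (\<forall>x. (k\<^sup>2 - (l - c x) * r x) * u x + r x \<le> h x))"
proof
  assume "supersolution l u"
  then obtain u1 u2 where u: "\<And>x. (u has_real_derivative u1 x) (at x)"
    "\<And>x. (u1 has_real_derivative u2 x) (at x)" "\<And>x. u2 x \<le> ((l - c x) * u x - 1) * r x"
    and pos: "\<And>x. 0 < u x" and per: "periodic_fun_simple' u"
    unfolding supersolution_def by metis
  have "helmholtz k (\<lambda>x. k\<^sup>2 * u x - u2 x) u"
    unfolding helmholtz_def using u per by auto
  moreover have "(k\<^sup>2 - (l - c x) * r x) * u x + r x \<le> k\<^sup>2 * u x - u2 x" for x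
    using u(3)[of x] by (simp add: algebra_simps)
  ultimately show "(\<forall>x. 0 < u x) \<and>
     (\<exists>h. helmholtz k h u \<and> (\<forall>x. (k\<^sup>2 - (l - c x) * r x) * u x + r x \<le> h x))"
    using pos by blast
next
  assume "(\<forall>x. 0 < u x) \<and>
     (\<exists>h. helmholtz k h u \<and> (\<forall>x. (k\<^sup>2 - (l - c x) * r x) * u x + r x \<le> h x))"
  then obtain h u1 where u: "\<And>x. (u has_real_derivative u1 x) (at x)"
    "\<And>x. (u1 has_real_derivative k\<^sup>2 * u x - h x) (at x)"
    and h: "\<And>x. (k\<^sup>2 - (l - c x) * r x) * u x + r x \<le> h x"
    and pos: "\<And>x. 0 < u x" and per: "periodic_fun_simple' u"
    unfolding helmholtz_def by metis
  have "k\<^sup>2 * u x - h x \<le> ((l - c x) * u x - 1) * r x" for x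
    using h[of x] by (simp add: algebra_simps)
  then show "supersolution l u" unfolding supersolution_def
    using u pos per by (intro conjI exI[of _ u1] exI[of _ "\<lambda>x. k\<^sup>2 * u x - h x"]) auto
qed

lemma exact_solution_of_supersolution:
  assumes "supersolution l u" and k: "k \<noteq> 0" "\<And>x. (l - c x) * r x \<le> k\<^sup>2"
  obtains w where "helmholtz k (\<lambda>x. (k\<^sup>2 - (l - c x) * r x) * w x + r x) w" "supersolution l w"
proof -
  define p where "p = (\<lambda>x. k\<^sup>2 - (l - c x) * r x)"
  obtain h where h: "helmholtz k h u" "\<And>x. p x * u x + r x \<le> h x" "\<And>x. 0 < u x"
    using assms(1) unfolding supersolution_iff_helmholtz[of l u k] p_def by blast
  have "periodic_fun_simple' p"
    using c_periodic r_periodic by (simp add: p_def periodic_fun_simple'_def)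
  moreover have "continuous_on UNIV p"
    unfolding p_def by (intro continuous_intros c_continuous r_continuous)
  moreover have p_nonneg: "0 \<le> p x" for x using k by (simp add: p_def)
  ultimately obtain w where w: "helmholtz k (\<lambda>x. p x * w x + r x) w" "\<And>x. 0 \<le> w x"
    using helmholtz_solution_below_supersolution[OF _ _ _ r_periodic r_continuous _ h(1) _ h(2) k(1)]
      r_pos h(3) by (metis less_imp_le)
  \<comment> \<open>The iteration gives only \<open>w \<ge> 0\<close>; at a minimum of
    \<open>w\<close> the strictly positive term \<open>r\<close> forces
    \<open>k\<^sup>2 * w > 0\<close>.\<close>
  have "0 < w x" for x
  proof -
    obtain x0 where x0: "\<And>x. w x0 \<le> w x" "p x0 * w x0 + r x0 \<le> k\<^sup>2 * w x0"
      using helmholtz_min[OF w(1)] by blast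
    have "0 < k\<^sup>2 * w x0"
      using x0(2) r_pos[of x0] mult_nonneg_nonneg[OF p_nonneg[of x0] w(2)[of x0]] by linarith
    then show ?thesis using x0(1)[of x] by (simp add: zero_less_mult_iff not_le)
  qed
  then have "supersolution l w"
    unfolding supersolution_iff_helmholtz[of l w k] using w(1) unfolding p_def by blast
  then show thesis using that w(1) unfolding p_def by blast
qed

text \<open>On the circle \<open>u\<close> is bounded, so \<open>supersolution_lower\<close> applies
  with \<open>t\<close> equal to half the reciprocal of its maximum.\<close>

lemma supersolution_at_smaller_value:
  assumes "supersolution l u" shows "\<exists>l'<l. \<exists>u'. supersolution l' u'"
proof -
  obtain x0 where x0: "\<And>x. u x \<le> u x0"
    using periodic_attains_max supersolution_continuous assms unfolding supersolution_def by metis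
  define t where "t = 1 / (2 * u x0)"
  have pos: "0 < u x" for x using assms by (simp add: supersolution_def)
  have "0 < t" using pos by (simp add: t_def)
  have "t * u x \<le> 1 / 2" for x
  proof -
    have "t * u x \<le> t * u x0" using x0 \<open>0 < t\<close> by (intro mult_left_mono) auto
    then show ?thesis using pos[of x0] by (simp add: t_def)
  qed
  then have "supersolution (l - t) (\<lambda>x. 2 * u x)"
    using supersolution_lower[of "l - t" t u] assms by simp
  then show ?thesis using \<open>0 < t\<close> by (intro exI[of _ "l - t"]) auto
qed

text \<open>The bound \<open>l0\<close> makes the infimum finite. The resulting equation reads
  \<open>v'' = (l - c) r v\<close>, with the same \<open>k\<close> terms on both sides
  cancelling.\<close>

lemma eigenfunction_at_Inf:
  assumes lower: "\<And>l u. supersolution l u \<Longrightarrow> l0 \<le> l"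
  obtains l k v where "l0 \<le> l" "helmholtz k (\<lambda>x. (k\<^sup>2 - (l - c x) * r x) * v x) v" "\<exists>x. v x \<noteq> 0"
proof -
  define S where "S = {l. \<exists>u. supersolution l u}"
  define l where "l = Inf S"
  have "S \<noteq> {}" using supersolution_exists by (auto simp: S_def)
  have "bdd_below S" using lower by (auto simp: S_def intro!: bdd_belowI[of _ l0])
  have "l0 \<le> l" unfolding l_def using \<open>S \<noteq> {}\<close> lower by (intro cInf_greatest) (auto simp: S_def)
  have l_notin: "l \<notin> S"
  proof
    assume "l \<in> S"
    then obtain l' where "l' < l" "l' \<in> S" using supersolution_at_smaller_value unfolding S_def by blast
    then show False using cInf_lower[OF \<open>l' \<in> S\<close> \<open>bdd_below S\<close>] by (simp add: l_def)
  qed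
  have l_in: "l' \<in> S" if less: "l < l'" for l'
  proof -
    obtain l'' where l'': "l'' \<in> S" "l'' < l'"
      using cInf_lessD[OF \<open>S \<noteq> {}\<close>, of l'] less by (auto simp: l_def)
    then obtain u where "supersolution l'' u" by (auto simp: S_def)
    then have "supersolution l' u" by (rule supersolution_mono) (simp add: l''(2) less_imp_le)
    then show ?thesis by (auto simp: S_def)
  qed
  define t where "t = (\<lambda>n. 1 / real (Suc n))"
  have t: "0 < t n" "t n \<le> 1" for n by (auto simp: t_def)
  define q where "q = (\<lambda>t x. (l + t - c x) * r x)"
  have q_per: "periodic_fun_simple' (q s)" for s
    using c_periodic r_periodic by (simp add: q_def periodic_fun_simple'_def)
  have q_cont: "continuous_on UNIV (q s)" for s
    unfolding q_def by (intro continuous_intros c_continuous r_continuous)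
  have q_mono: "q s x \<le> q s' x" if "s \<le> s'" for s s' x
    unfolding q_def using that r_pos[of x] by (intro mult_right_mono) auto
  obtain xq where xq: "\<And>x. q 1 x \<le> q 1 xq" using periodic_attains_max q_per q_cont by metis
  obtain xm where xm: "\<And>x. q 0 xm \<le> q 0 x" using periodic_attains_min q_per q_cont by metis
  obtain xr where xr: "\<And>x. r x \<le> r xr" using periodic_attains_max r_periodic r_continuous by metis
  \<comment> \<open>One nonzero \<open>k\<close> that serves every \<open>t n \<le> 1\<close>: its
    square dominates the largest value of \<open>q 1\<close>, hence of every \<open>q s\<close> with
    \<open>s \<le> 1\<close>.\<close>
  define k where "k = 1 + \<bar>q 1 xq\<bar>"
  have "k \<noteq> 0" by (simp add: k_def add_nonneg_eq_0_iff)
  have k2: "q s x \<le> k\<^sup>2" if "s \<le> 1" for s x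
  proof -
    have "q s x \<le> \<bar>q 1 xq\<bar>" using q_mono[OF that, of x] xq[of x] by linarith
    also have "\<dots> \<le> k\<^sup>2" by (simp add: k_def power2_eq_square algebra_simps)
    finally show ?thesis .
  qed
  \<comment> \<open>A bound for the coefficients \<open>k\<^sup>2 - q s\<close>, uniform in
    \<open>s\<close> between 0 and 1, because \<open>q s\<close> is increasing in
    \<open>s\<close>.\<close>
  define P where "P = k\<^sup>2 - q 0 xm"
  have P: "0 \<le> k\<^sup>2 - q s x" "k\<^sup>2 - q s x \<le> P" if "0 \<le> s" "s \<le> 1" for s x
    using k2[OF that(2)] q_mono[OF that(1), of x] xm[of x] by (auto simp: P_def)
  have "\<exists>w. helmholtz k (\<lambda>x. (k\<^sup>2 - q (t n) x) * w x + r x) w \<and> supersolution (l + t n) w" for n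
    using exact_solution_of_supersolution[of "l + t n" _ k] l_in[of "l + t n"] t[of n] k2[of "t n"] \<open>k \<noteq> 0\<close>
    unfolding q_def S_def by fastforce
  then obtain w where w: "\<And>n. helmholtz k (\<lambda>x. (k\<^sup>2 - q (t n) x) * w n x + r x) (w n)"
      "\<And>n. supersolution (l + t n) (w n)" by metis
  have w_pos: "0 < w n x" for n x using w(2)[of n] by (simp add: supersolution_def)
  have "\<exists>z. \<forall>x. w n x \<le> w n z" for n
    using periodic_attains_max[OF helmholtz_periodic helmholtz_continuous] w(1) by metis
  then obtain z where z: "\<And>n x. w n x \<le> w n (z n)" by metis
  define m where "m = (\<lambda>n. w n (z n))"
  have m_pos: "0 < m n" for n using w_pos by (simp add: m_def)
  text \<open>If \<open>w n\<close> were small, \<open>2 * w n\<close> would be a supersolution at the infimum itself.\<close>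
  have m_large: "1 / m n < 2 * t n" for n
  proof (rule ccontr)
    assume "\<not> 1 / m n < 2 * t n"
    then have "t n * m n \<le> 1 / 2" using m_pos[of n] by (simp add: field_simps)
    moreover have "t n * w n x \<le> t n * m n" for x
      using z t(1)[of n] by (auto simp: m_def intro: mult_left_mono)
    ultimately have "t n * w n x \<le> 1 / 2" for x by (meson order.trans)
    then have "l \<in> S" using supersolution_lower[OF w(2)[of n]] by (auto simp: S_def)
    then show False using l_notin by simp
  qed
  \<comment> \<open>Normalised to maximum one. The source term becomes \<open>r / m n\<close>, which
    tends to zero since \<open>1 / m n < 2 * t n\<close>.\<close>
  define v where "v = (\<lambda>n x. w n x / m n)"
  define h where "h = (\<lambda>n x. (k\<^sup>2 - q (t n) x) * v n x + r x / m n)"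
  have v: "0 < v n x" "v n x \<le> 1" for n x
    using w_pos z m_pos by (auto simp: v_def m_def)
  have hv: "helmholtz k (h n) (v n)" for n
    using helmholtz_cmult[OF w(1)[of n], of "1 / m n"] by (simp add: h_def[abs_def] v_def add_divide_distrib distrib_left)
  have rm: "0 < r x / m n" "r x / m n \<le> 2 * r xr * t n" for n x
  proof -
    have "r x * (1 / m n) \<le> r xr * (2 * t n)"
      using xr[of x] m_large[of n] m_pos[of n] r_pos[of xr] by (intro mult_mono) auto
    then show "r x / m n \<le> 2 * r xr * t n" by simp
    show "0 < r x / m n" using r_pos m_pos by simp
  qed
  have h_bound: "\<bar>h n x\<bar> \<le> P + 2 * r xr" for n x
  proof -
    have "(k\<^sup>2 - q (t n) x) * v n x \<le> P * 1" "0 \<le> (k\<^sup>2 - q (t n) x) * v n x"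
      using P[of "t n" x] t[of n] v[of n x] mult_mono[of "k\<^sup>2 - q (t n) x" P "v n x" 1] by auto
    moreover have "2 * r xr * t n \<le> 2 * r xr * 1" using t[of n] r_pos[of xr] by (intro mult_left_mono) auto
    ultimately show ?thesis using rm[where n = n and x = x] by (simp add: h_def)
  qed
  obtain s u where s: "strict_mono s" "uniform_limit UNIV (\<lambda>n. v (s n)) u sequentially"
    by (rule helmholtz_compact[OF hv h_bound \<open>k \<noteq> 0\<close>])
  have su: "(\<lambda>n. v (s n) x) \<longlonglongrightarrow> u x" for x
    using tendsto_uniform_limitI[OF s(2)] by auto
  have u: "periodic_fun_simple' u" "continuous_on UNIV u"
    using uniform_limit_periodic[OF s(2)] uniform_limit_theorem[OF _ s(2)]
      helmholtz_periodic[OF hv] helmholtz_continuous[OF hv] by auto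
  have ts: "(\<lambda>n. t (s n)) \<longlonglongrightarrow> 0"
    using LIMSEQ_subseq_LIMSEQ[OF LIMSEQ_Suc[OF lim_1_over_n] s(1)] by (simp add: t_def o_def)
  define h' where "h' = (\<lambda>x. (k\<^sup>2 - q 0 x) * u x)"
  \<comment> \<open>Of the three multiples of \<open>r xr * t n\<close>, one comes from replacing
    \<open>q (t n)\<close> by \<open>q 0\<close> and two from the term
    \<open>r x / m n\<close>.\<close>
  have h_diff: "\<bar>h n x - h' x\<bar> \<le> P * \<bar>v n x - u x\<bar> + 3 * r xr * t n" for n x
  proof -
    have "h n x - h' x = (k\<^sup>2 - q 0 x) * (v n x - u x) - t n * r x * v n x + r x / m n"
      by (simp add: h_def h'_def q_def algebra_simps)
    moreover have "\<bar>(k\<^sup>2 - q 0 x) * (v n x - u x)\<bar> \<le> P * \<bar>v n x - u x\<bar>"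
      using P[of 0 x] by (simp add: abs_mult mult_right_mono)
    moreover have "\<bar>t n * r x * v n x\<bar> \<le> r xr * t n"
    proof -
      have "r x * v n x \<le> r xr * 1" using v[of n x] xr[of x] r_pos[of x] r_pos[of xr] by (intro mult_mono) auto
      then have "t n * (r x * v n x) \<le> t n * r xr" using t(1)[of n] by (intro mult_left_mono) auto
      moreover have "0 \<le> t n * r x * v n x" using t(1)[of n] r_pos[of x] v(1)[of n x] by simp
      ultimately show ?thesis by (simp add: mult.commute mult.left_commute)
    qed
    ultimately show ?thesis using rm[where n = n and x = x] by linarith
  qed
  have "uniform_limit UNIV (\<lambda>n. h (s n)) h' sequentially"
  proof (rule uniform_limitI)
    fix e :: real assume "0 < e"
    have "0 \<le> P" using P[of 0 0] by simp
    then have "0 < e / (2 * (P + 1))" using \<open>0 < e\<close> by simp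
    note E1 = uniform_limitD[OF s(2) this]
    have "0 < e / (6 * r xr)" using \<open>0 < e\<close> r_pos by simp
    note E2 = tendstoD[OF ts this]
    from E1 E2 show "\<forall>\<^sub>F n in sequentially. \<forall>x\<in>UNIV. dist (h (s n) x) (h' x) < e"
    proof eventually_elim
      case (elim n)
      show ?case
      proof
        fix x
        have "\<bar>v (s n) x - u x\<bar> < e / (2 * (P + 1))" using elim(1) by (simp add: dist_real_def)
        then have "(P + 1) * \<bar>v (s n) x - u x\<bar> < e / 2" using \<open>0 \<le> P\<close> by (simp add: field_simps)
        then have "P * \<bar>v (s n) x - u x\<bar> < e / 2"
          unfolding distrib_right by (rule le_less_trans[rotated]) simp
        moreover have "3 * r xr * t (s n) < e / 2"
          using elim(2) t(1)[of "s n"] r_pos[of xr] by (simp add: dist_real_def field_simps)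
        ultimately show "dist (h (s n) x) (h' x) < e"
          using h_diff[of "s n" x] by (simp add: dist_real_def)
      qed
    qed
  qed
  moreover have "periodic_fun_simple' h'" "continuous_on UNIV h'"
    using u q_per[of 0] by (auto simp: h'_def periodic_fun_simple'_def intro!: continuous_intros q_cont)
  ultimately have "helmholtz k h' u"
    using helmholtz_limit[of k "\<lambda>n. h (s n)" "\<lambda>n. v (s n)"] hv \<open>k \<noteq> 0\<close> su by blast
  \<comment> \<open>The maximum points \<open>z (s n)\<close> may wander, but uniform closeness
    below one at a single index already excludes \<open>u = 0\<close> where \<open>v (s n)\<close>
    equals one.\<close>
  moreover have "\<exists>x. u x \<noteq> 0"
  proof -
    obtain n where "\<And>x. \<bar>v (s n) x - u x\<bar> < 1"
      using uniform_limitD[OF s(2), of 1] by (auto simp: eventually_sequentially dist_real_def)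
    moreover have "v (s n) (z (s n)) = 1" using m_pos[of "s n"] by (simp add: v_def m_def)
    ultimately have "u (z (s n)) \<noteq> 0" by (metis abs_one diff_zero less_irrefl)
    then show ?thesis by blast
  qed
  ultimately show thesis using that[OF \<open>l0 \<le> l\<close>] by (simp add: h'_def q_def)
qed

end

section \<open>Sturm comparison\<close>

text \<open>The Wronskian-type function \<open>g\<close> of \<open>u\<close> and the sine arch over
  the interval from \<alpha> to \<beta> is nonincreasing there, as its derivative is
  \<open>(u2 + b\<^sup>2 u)\<close> times the sine. Its end values are
  \<open>- b * u \<alpha> < 0\<close> and \<open>b * u \<beta> > 0\<close>, a contradiction.\<close>

lemma no_positive_solution_on_long_interval:
  fixes u :: "real \<Rightarrow> real"
  assumes "\<alpha> < \<beta>" and d1: "\<And>x. (u has_real_derivative u1 x) (at x)"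
    and d2: "\<And>x. (u1 has_real_derivative u2 x) (at x)" and pos: "\<And>x. 0 < u x"
    and le: "\<And>x. \<alpha> \<le> x \<Longrightarrow> x \<le> \<beta> \<Longrightarrow> u2 x \<le> - (pi / (\<beta> - \<alpha>))\<^sup>2 * u x"
  shows False
proof -
  define b where "b = pi / (\<beta> - \<alpha>)"
  have "0 < b" using \<open>\<alpha> < \<beta>\<close> by (simp add: b_def)
  define g where "g = (\<lambda>x. u1 x * sin (b * (x - \<alpha>)) - u x * (b * cos (b * (x - \<alpha>))))"
  have bl: "b * (\<beta> - \<alpha>) = pi" using \<open>\<alpha> < \<beta>\<close> by (simp add: b_def)
  have g: "(g has_real_derivative (u2 x + b\<^sup>2 * u x) * sin (b * (x - \<alpha>))) (at x)" for x
    unfolding g_def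
    by (auto intro!: derivative_eq_intros d1 d2 simp: algebra_simps power2_eq_square)
  have "g \<beta> \<le> g \<alpha>"
  proof (rule DERIV_nonpos_imp_nonincreasing[of \<alpha> \<beta> g])
    show "\<alpha> \<le> \<beta>" using \<open>\<alpha> < \<beta>\<close> by simp
    fix x assume x: "\<alpha> \<le> x" "x \<le> \<beta>"
    have "b * (x - \<alpha>) \<le> b * (\<beta> - \<alpha>)" using x \<open>0 < b\<close> by (intro mult_left_mono) auto
    then have "0 \<le> sin (b * (x - \<alpha>))"
      using x \<open>0 < b\<close> bl by (intro sin_ge_zero) auto
    then have "(u2 x + b\<^sup>2 * u x) * sin (b * (x - \<alpha>)) \<le> 0"
      using le[OF x] by (intro mult_nonpos_nonneg) (auto simp: b_def)
    then show "\<exists>y. (g has_real_derivative y) (at x) \<and> y \<le> 0" using g by blast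
  qed
  moreover have "g \<alpha> = - (u \<alpha> * b)" "g \<beta> = u \<beta> * b"
    unfolding g_def by (simp_all add: bl)
  moreover have "0 < u \<alpha> * b" "0 < u \<beta> * b" using pos \<open>0 < b\<close> by simp_all
  ultimately show False by linarith
qed

subsection \<open>Eigenvalues of \<open>L\<^sub>\<epsilon>\<close>\<close>

lemma circle_C2_derivatives:
  assumes "circle_C2 u"
  shows "(u has_vector_derivative vderiv u x) (at x)"
    and "(vderiv u has_vector_derivative vderiv (vderiv u) x) (at x)"
    and "vderiv u (x + 1) = vderiv u x"
proof -
  show 1: "(u has_vector_derivative vderiv u x) (at x)" for x
    using assms unfolding circle_C2_def C1_differentiable_on_def
    by (metis UNIV_I vector_derivative_at)
  show "(vderiv u has_vector_derivative vderiv (vderiv u) x) (at x)"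
    using assms unfolding circle_C2_def C1_differentiable_on_def
    by (metis UNIV_I vector_derivative_at)
  have "((\<lambda>x. x + 1) has_real_derivative 1) (at x)" by (auto intro!: derivative_eq_intros)
  then have "(u \<circ> (\<lambda>x. x + 1) has_vector_derivative 1 *\<^sub>R vderiv u (x + 1)) (at x)"
    by (intro vector_diff_chain_at 1) (simp add: has_real_derivative_iff_has_vector_derivative)
  moreover have "u \<circ> (\<lambda>x. x + 1) = u"
    using assms by (auto simp: circle_C2_def periodic_fun_simple'_def)
  ultimately show "vderiv u (x + 1) = vderiv u x" using vector_derivative_at by fastforce
qed

text \<open>Dividing by \<epsilon> a turns the problem into \<open>u'' + c r u = \<mu> r u\<close>,
  which is symmetric with weight \<open>r\<close>. The derivative of \<open>cnj u * u'\<close>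
  carries the usual energy identity in pointwise form.\<close>

lemma eigenvalue_real_and_bounded:
  assumes eig: "is_eigenvalue a c \<epsilon> \<mu>" and "\<epsilon> > 0" and a: "\<And>x. a x > 0" and M: "\<And>x. c x \<le> M"
  shows "Im \<mu> = 0" "Re \<mu> \<le> M"
proof -
  obtain u x0 where C2: "circle_C2 u" and "u x0 \<noteq> 0" and L: "\<And>x. L_op a c \<epsilon> u x = \<mu> * u x"
    using eig unfolding is_eigenvalue_def by blast
  define u1 where "u1 = vderiv u"
  define r where "r = (\<lambda>x. 1 / (\<epsilon> * a x))"
  have r: "0 < r x" for x using a \<open>\<epsilon> > 0\<close> by (simp add: r_def)
  have d1: "(u has_vector_derivative u1 x) (at x)" for x
    using circle_C2_derivatives[OF C2] by (simp add: u1_def)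
  have d2: "(u1 has_vector_derivative (\<mu> - c x) * r x * u x) (at x)" for x
  proof -
    have ne: "complex_of_real (\<epsilon> * a x) \<noteq> 0" using a[of x] \<open>\<epsilon> > 0\<close> by simp
    have "complex_of_real (\<epsilon> * a x) * vderiv u1 x = (\<mu> - c x) * u x"
      using L[of x] by (simp add: L_op_def u1_def scaleR_conv_of_real algebra_simps)
    then have "vderiv u1 x = (\<mu> - c x) * u x / complex_of_real (\<epsilon> * a x)"
      using ne by (metis nonzero_mult_div_cancel_left)
    then have "vderiv u1 x = (\<mu> - c x) * r x * u x" by (simp add: r_def)
    then show ?thesis using circle_C2_derivatives(2)[OF C2, of x] by (simp add: u1_def)
  qed
  define w where "w = (\<lambda>x. cnj (u x) * u1 x)"
  define w' where "w' = (\<lambda>x. of_real ((cmod (u1 x))\<^sup>2) + (\<mu> - c x) * of_real (r x * (cmod (u x))\<^sup>2))"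
  have w: "(w has_vector_derivative w' x) (at x)" for x
  proof -
    have "(w has_vector_derivative cnj (u x) * ((\<mu> - c x) * r x * u x) + cnj (u1 x) * u1 x) (at x)"
      unfolding w_def by (intro has_vector_derivative_mult has_vector_derivative_cnj d1 d2)
    moreover have "cnj (u x) * ((\<mu> - c x) * r x * u x) + cnj (u1 x) * u1 x = w' x"
      unfolding w'_def complex_norm_square of_real_mult by (simp add: algebra_simps)
    ultimately show ?thesis by simp
  qed
  have wper: "w (x + 1) = w x" for x
    using circle_C2_derivatives(3)[OF C2, of x] C2
    by (simp add: w_def u1_def circle_C2_def periodic_fun_simple'_def)
  have Re_w: "((\<lambda>x. Re (w x)) has_real_derivative Re (w' x)) (at x)" for x
    using bounded_linear.has_vector_derivative[OF bounded_linear_Re w]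
    by (simp add: has_real_derivative_iff_has_vector_derivative)
  have Im_w: "((\<lambda>x. Im (w x)) has_real_derivative Im (w' x)) (at x)" for x
    using bounded_linear.has_vector_derivative[OF bounded_linear_Im w]
    by (simp add: has_real_derivative_iff_has_vector_derivative)
  have Im_w': "Im (w' x) = Im \<mu> * (r x * (cmod (u x))\<^sup>2)" for x
    by (simp add: w'_def)
  have Re_w': "Re (w' x) = (cmod (u1 x))\<^sup>2 + (Re \<mu> - c x) * (r x * (cmod (u x))\<^sup>2)" for x
    by (simp add: w'_def)
  have nn: "0 \<le> r x * (cmod (u x))\<^sup>2" for x using r[of x] by simp
  have pos: "0 < r x0 * (cmod (u x0))\<^sup>2" using r[of x0] \<open>u x0 \<noteq> 0\<close> by simp
  \<comment> \<open>The extra factor \<open>Im \<mu>\<close> turns the derivative into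
    \<open>(Im \<mu>)\<^sup>2\<close> times a nonnegative function, so the sign of
    \<open>Im \<mu>\<close> need not be known.\<close>
  have "Im \<mu> * Im (w' x0) = 0"
  proof (rule periodic_mono_imp_deriv_zero[where x = x0 and g' = "\<lambda>x. Im \<mu> * Im (w' x)"])
    show "periodic_fun_simple' (\<lambda>x. Im \<mu> * Im (w x))" by (simp add: periodic_fun_simple'_def wper)
    show "((\<lambda>x. Im \<mu> * Im (w x)) has_real_derivative Im \<mu> * Im (w' x)) (at x)" for x
      using Im_w by (rule DERIV_cmult)
    show "0 \<le> Im \<mu> * Im (w' x)" for x
      using mult_nonneg_nonneg[OF zero_le_square[of "Im \<mu>"] nn[of x]] by (simp add: Im_w' mult.assoc)
  qed
  then show "Im \<mu> = 0" using pos by (auto simp: Im_w')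
  show "Re \<mu> \<le> M"
  proof (rule ccontr)
    assume "\<not> Re \<mu> \<le> M"
    then have gap: "0 < Re \<mu> - c x" for x using M[of x] by linarith
    have "Re (w' x0) = 0"
    proof (rule periodic_mono_imp_deriv_zero[where x = x0 and g' = "\<lambda>x. Re (w' x)"])
      show "periodic_fun_simple' (\<lambda>x. Re (w x))" by (simp add: periodic_fun_simple'_def wper)
      show "0 \<le> Re (w' x)" for x
        using mult_nonneg_nonneg[OF less_imp_le[OF gap] nn] by (simp add: Re_w')
    qed (rule Re_w)
    then show False
      using mult_pos_pos[OF gap[of x0] pos] zero_le_power2[of "cmod (u1 x0)"] unfolding Re_w' by linarith
  qed
qed

lemma is_eigenvalue_of_real:
  assumes v: "periodic_fun_simple' v" "\<exists>x. v x \<noteq> 0"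
    and d1: "\<And>x. (v has_real_derivative v1 x) (at x)"
    and d2: "\<And>x. (v1 has_real_derivative v2 x) (at x)" and cont: "continuous_on UNIV v2"
    and eq: "\<And>x. \<epsilon> * a x * v2 x + c x * v x = l * v x"
  shows "is_eigenvalue a c \<epsilon> (of_real l)"
proof -
  define u where "u = (\<lambda>x. complex_of_real (v x))"
  have 1: "(u has_vector_derivative of_real (v1 x)) (at x)" for x
    unfolding u_def by (intro has_vector_derivative_of_real d1)
  then have vd: "vderiv u = (\<lambda>x. of_real (v1 x))" using vector_derivative_at by blast
  have 2: "(vderiv u has_vector_derivative of_real (v2 x)) (at x)" for x
    unfolding vd by (intro has_vector_derivative_of_real d2)
  then have vd2: "vderiv (vderiv u) = (\<lambda>x. of_real (v2 x))" using vector_derivative_at by blast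
  have "continuous_on UNIV v1" using d2 by (meson DERIV_isCont continuous_at_imp_continuous_on)
  then have "u C1_differentiable_on UNIV"
    unfolding C1_differentiable_on_def using 1
    by (intro exI[of _ "\<lambda>x. of_real (v1 x)"]) (auto intro!: continuous_intros)
  moreover have "vderiv u C1_differentiable_on UNIV"
    unfolding C1_differentiable_on_def using 2 cont
    by (intro exI[of _ "\<lambda>x. of_real (v2 x)"]) (auto intro!: continuous_intros)
  moreover have "periodic_fun_simple' u" using v(1) by (simp add: u_def periodic_fun_simple'_def)
  ultimately have "circle_C2 u" by (simp add: circle_C2_def)
  moreover have "L_op a c \<epsilon> u x = of_real l * u x" for x
    using arg_cong[OF eq[of x], of complex_of_real] unfolding L_op_def fun_cong[OF vd2]
    by (simp add: u_def scaleR_conv_of_real)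
  moreover have "\<exists>x. u x \<noteq> 0" using v(2) by (simp add: u_def)
  ultimately show ?thesis unfolding is_eigenvalue_def by blast
qed

section \<open>The lower bound for small \<epsilon> and the limit\<close>

text \<open>If a supersolution existed for some \<open>l < c x0 - \<delta>\<close>, then near
  \<open>x0\<close> it would satisfy \<open>u'' \<le> - (\<delta> / 2) r u\<close>. As
  \<open>r\<close> is of order \<open>1 / \<epsilon>\<close>, this eventually beats the threshold of
  the Sturm comparison, so the infimum of admissible values is at least
  \<open>c x0 - \<delta>\<close>.\<close>

lemma eigenvalue_near_maximum:
  fixes a c :: "real \<Rightarrow> real"
  assumes a: "periodic_fun_simple' a" "continuous_on UNIV a" "\<And>x. a x > 0"
    and c: "periodic_fun_simple' c" "continuous_on UNIV c" and "\<delta> > 0"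
  shows "\<exists>\<epsilon>0>0. \<forall>\<epsilon>. 0 < \<epsilon> \<longrightarrow> \<epsilon> < \<epsilon>0 \<longrightarrow> (\<exists>l. c x0 - \<delta> \<le> l \<and> is_eigenvalue a c \<epsilon> (of_real l))"
proof -
  obtain xa where xa: "\<And>x. a x \<le> a xa" using periodic_attains_max a(1,2) by metis
  have "isCont c x0" using c(2) by (simp add: continuous_on_eq_continuous_at)
  then obtain d where d: "d > 0" "\<And>x. \<bar>x - x0\<bar> < d \<Longrightarrow> \<bar>c x - c x0\<bar> < \<delta> / 2"
    using \<open>\<delta> > 0\<close> unfolding continuous_at_eps_delta by (metis dist_real_def half_gt_zero)
  \<comment> \<open>Half of \<open>d\<close> keeps the closed interval up to \<beta> inside the open
    neighbourhood where \<open>c\<close> is controlled.\<close>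
  define \<beta> where "\<beta> = x0 + d / 2"
  define b where "b = pi / (\<beta> - x0)"
  have "x0 < \<beta>" "0 < b" using d(1) by (auto simp: \<beta>_def b_def)
  \<comment> \<open>Chosen so that \<open>\<epsilon> < \<epsilon>0\<close> gives
    \<open>(\<delta> / 2) * r x \<ge> b\<^sup>2\<close> at every point, the largest value
    \<open>a xa\<close> being the worst case.\<close>
  define \<epsilon>0 where "\<epsilon>0 = (\<delta> / 2) / (a xa * b\<^sup>2)"
  have "\<epsilon>0 > 0" using a(3) \<open>0 < b\<close> \<open>\<delta> > 0\<close> by (simp add: \<epsilon>0_def)
  moreover have "\<exists>l. c x0 - \<delta> \<le> l \<and> is_eigenvalue a c \<epsilon> (of_real l)" if "0 < \<epsilon>" "\<epsilon> < \<epsilon>0" for \<epsilon>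
  proof -
    define r where "r = (\<lambda>x. 1 / (\<epsilon> * a x))"
    have ea: "0 < \<epsilon> * a x" for x using \<open>0 < \<epsilon>\<close> a(3) by simp
    have r_cont: "continuous_on UNIV r"
      unfolding r_def using ea by (intro continuous_intros a(2)) (auto simp: less_le)
    interpret circle_coefficients c r
      by unfold_locales
        (use a c r_cont ea in \<open>auto simp: r_def periodic_fun_simple'_def\<close>)
    have r_large: "b\<^sup>2 \<le> \<delta> / 2 * r x" for x
    proof -
      have "\<epsilon> * (a x * b\<^sup>2) \<le> \<epsilon>0 * (a xa * b\<^sup>2)"
        using that xa[of x] a(3)[of x] by (intro mult_mono mult_right_mono) auto
      also have "\<dots> = \<delta> / 2" using a(3)[of xa] \<open>0 < b\<close> by (simp add: \<epsilon>0_def)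
      finally show ?thesis using ea[of x] a(3)[of x] \<open>0 < \<epsilon>\<close> by (simp add: r_def field_simps)
    qed
    have lower: "c x0 - \<delta> \<le> l" if super: "supersolution l u" for l u
    proof (rule ccontr)
      assume l: "\<not> c x0 - \<delta> \<le> l"
      obtain u1 u2 where u: "\<And>x. (u has_real_derivative u1 x) (at x)"
        "\<And>x. (u1 has_real_derivative u2 x) (at x)" "\<And>x. u2 x \<le> ((l - c x) * u x - 1) * r x"
        and pos: "\<And>x. 0 < u x"
        using super unfolding supersolution_def by metis
      have "u2 x \<le> - b\<^sup>2 * u x" if "x0 \<le> x" "x \<le> \<beta>" for x
      proof -
        have "\<bar>c x - c x0\<bar> < \<delta> / 2" using that d(1) by (intro d(2)) (auto simp: \<beta>_def)
        then have "l - c x \<le> - (\<delta> / 2)" using l by linarith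
        then have "(l - c x) * u x \<le> - (\<delta> / 2) * u x" using pos[of x] by (intro mult_right_mono) auto
        then have "((l - c x) * u x - 1) * r x \<le> (- (\<delta> / 2) * u x) * r x"
          using r_pos[of x] by (intro mult_right_mono) auto
        moreover have "b\<^sup>2 * u x \<le> \<delta> / 2 * r x * u x"
          using r_large pos[of x] by (intro mult_right_mono) auto
        ultimately show ?thesis using u(3)[of x] by (simp add: algebra_simps)
      qed
      then show False
        using no_positive_solution_on_long_interval[OF \<open>x0 < \<beta>\<close> u(1,2) pos] unfolding b_def by blast
    qed
    obtain l k v where l: "c x0 - \<delta> \<le> l"
      and v: "helmholtz k (\<lambda>x. (k\<^sup>2 - (l - c x) * r x) * v x) v" "\<exists>x. v x \<noteq> 0"
      by (rule eigenfunction_at_Inf[OF lower])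
    obtain v1 where d: "\<And>x. (v has_real_derivative v1 x) (at x)"
      "\<And>x. (v1 has_real_derivative k\<^sup>2 * v x - (k\<^sup>2 - (l - c x) * r x) * v x) (at x)"
      using v(1) unfolding helmholtz_def by metis
    have "is_eigenvalue a c \<epsilon> (of_real l)"
    proof (rule is_eigenvalue_of_real[OF _ v(2) d(1)])
      show "(v1 has_real_derivative (l - c x) * r x * v x) (at x)" for x
        using d(2)[of x] by (simp add: algebra_simps)
      show "continuous_on UNIV (\<lambda>x. (l - c x) * r x * v x)"
        by (intro continuous_intros c(2) r_cont helmholtz_continuous[OF v(1)])
      show "\<epsilon> * a x * ((l - c x) * r x * v x) + c x * v x = l * v x" for x
      proof -
        have "\<epsilon> * a x * r x = 1" using \<open>0 < \<epsilon>\<close> a(3)[of x] by (simp add: r_def)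
        then have "\<epsilon> * a x * ((l - c x) * r x * v x) = (l - c x) * v x"
          by (metis mult.commute mult.left_commute mult.right_neutral)
        then show ?thesis by (simp add: algebra_simps)
      qed
      show "periodic_fun_simple' v" using v(1) by (rule helmholtz_periodic)
    qed
    then show ?thesis using l by blast
  qed
  ultimately show ?thesis by blast
qed

theorem proposition2p1:
  fixes a c :: "real \<Rightarrow> real" and lam :: "real \<Rightarrow> complex"
  assumes "circle_C2 a" and "\<And>x. a x > 0"
    and "circle_C0 c"
    and "\<And>\<epsilon>. \<epsilon> > 0 \<Longrightarrow> is_principal_eigenvalue a c \<epsilon> (lam \<epsilon>)"
  shows "(lam \<longlongrightarrow> complex_of_real (GREATEST y. y \<in> range c)) (at_right 0)"
proof -
  have c: "periodic_fun_simple' c" "continuous_on UNIV c"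
    using assms(3) by (auto simp: circle_C0_def)
  have a: "periodic_fun_simple' a" "continuous_on UNIV a"
    using assms(1) by (auto simp: circle_C2_def intro: C1_differentiable_imp_continuous_on)
  obtain x0 where x0: "\<And>x. c x \<le> c x0" using periodic_attains_max c by metis
  have "(GREATEST y. y \<in> range c) = c x0" using x0 by (intro Greatest_equality) auto
  moreover have "(lam \<longlongrightarrow> of_real (c x0)) (at_right 0)"
  proof (rule tendstoI)
    fix e :: real assume "0 < e"
    then obtain \<epsilon>0 where "\<epsilon>0 > 0" and eig: "\<And>\<epsilon>. 0 < \<epsilon> \<Longrightarrow> \<epsilon> < \<epsilon>0 \<Longrightarrow>
        \<exists>l. c x0 - e / 2 \<le> l \<and> is_eigenvalue a c \<epsilon> (of_real l)"
      using eigenvalue_near_maximum[OF a assms(2) c, of "e / 2" x0] by auto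
    have "dist (lam \<epsilon>) (of_real (c x0)) < e" if "\<epsilon> \<in> {0<..<\<epsilon>0}" for \<epsilon>
    proof -
      have \<epsilon>: "0 < \<epsilon>" "\<epsilon> < \<epsilon>0" using that by auto
      obtain l where l: "c x0 - e / 2 \<le> l" "is_eigenvalue a c \<epsilon> (of_real l)" using eig[OF \<epsilon>] by blast
      \<comment> \<open>Maximality of the real part transfers the lower bound from the constructed
        eigenvalue \<open>l\<close> to \<open>lam \<epsilon>\<close>; the upper bound and reality
        hold for every eigenvalue.\<close>
      have "is_eigenvalue a c \<epsilon> (lam \<epsilon>)" "l \<le> Re (lam \<epsilon>)"
        using assms(4)[OF \<epsilon>(1)] l(2) unfolding is_principal_eigenvalue_def by force+
      then have "Im (lam \<epsilon>) = 0" "Re (lam \<epsilon>) \<le> c x0" "c x0 - e / 2 \<le> Re (lam \<epsilon>)"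
        using eigenvalue_real_and_bounded[of a c \<epsilon> "lam \<epsilon>" "c x0"] \<epsilon>(1) assms(2) x0 l(1) by auto
      then have "lam \<epsilon> - of_real (c x0) = of_real (Re (lam \<epsilon>) - c x0)"
        by (simp add: complex_eq_iff)
      then have "dist (lam \<epsilon>) (of_real (c x0)) = \<bar>Re (lam \<epsilon>) - c x0\<bar>"
        by (simp only: dist_norm norm_of_real)
      then show ?thesis
        using \<open>Re (lam \<epsilon>) \<le> c x0\<close> \<open>c x0 - e / 2 \<le> Re (lam \<epsilon>)\<close> \<open>0 < e\<close> by linarith
    qed
    then show "\<forall>\<^sub>F \<epsilon> in at_right 0. dist (lam \<epsilon>) (of_real (c x0)) < e"
      using \<open>\<epsilon>0 > 0\<close> by (intro eventually_at_rightI) auto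
  qed
  ultimately show ?thesis by simp
qed

end
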